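(* Let $A,B$ be real numbers with $-1\le A<B\le 1$ and $B\neq 0$. Let $\lambda\in[0,1)$ and $z_0\in\mathbb{D}\setminus\{0\}$. Put $$c(z_0,\lambda)=\frac{1-\lambda^2|z_0|^2+\lambda B(1-|z_0|^2)z_0}{1-\lambda^2|z_0|^2},\qquad r(z_0,\lambda)=\frac{|B|(1-\lambda^2)|z_0|^2}{1-\lambda^2|z_0|^2}.$$ Then $$V_\lambda(z_0,A,B)=\left\{\left(\frac{A-B}{B}\right)\log\bigl(c(z_0,\lambda)+a\,r(z_0,\lambda)\bigr): a\in\mathbb{C},\ |a|\le 1\right\}.$$ The boundary $\partial V_\lambda(z_0,A,B)$ of this set is the Jordan curve given by $$(-\pi,\pi]\ni\theta\mapsto \log F'_{e^{i\theta},\lambda}(z_0)=\left(\frac{A-B}{B}\right)\log\bigl(1+Bz_0\,\delta(e^{i\theta}z_0,\lambda)\bigr).$$ Moreover, if $\log f'(z_0)=\log F'_{e^{i\theta},\lambda}(z_0)$ for some $f\in\mathcal{C}_\lambda(A,B)$ and some $\theta\in(-\pi,\pi]$, then $f=F_{e^{i\theta},\lambda}$ on $\mathbb{D}$.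
   Context: $\mathbb{D}=\{z\in\mathbb{C}:|z|<1\}$ and $\overline{\mathbb{D}}=\{z\in\mathbb{C}:|z|\le 1\}$. A Schwarz function is an analytic $\xi:\mathbb{D}\to\mathbb{D}$ with $\xi(0)=0$. For analytic $h,g$ on $\mathbb{D}$, $h\prec g$ ($h$ is subordinate to $g$) means that $h=g\circ\xi$ for some Schwarz function $\xi$. For real $A,B$ with $-1\le A<B\le 1$, $B\ne 0$, $\mathcal{C}(A,B)$ is the set of all analytic, locally univalent (i.e. $f'\neq 0$ everywhere) functions $f$ on $\mathbb{D}$ with $f(0)=0$, $f'(0)=1$ and $$\log f'(z)\prec\left(\frac{A}{B}-1\right)\log(1+Bz),\quad z\in\mathbb{D}.$$ Here $\log f'$ is the analytic branch on $\mathbb{D}$ with $\log f'(0)=0$, and $\log(1+Bz)$ is the branch vanishing at $z=0$; more generally $\log$ of numbers in the disc $\{|w-1|<1\}$ is the principal branch, and real powers are defined by means of these branches. For $\lambda\in\overline{\mathbb{D}}$, $\mathcal{C}_\lambda(A,B)=\{f\in\mathcal{C}(A,B): f''(0)=\lambda(A-B)\}$, and for $z_0\in\mathbb{D}$, $V_\lambda(z_0,A,B)=\{\log f'(z_0): f\in\mathcal{C}_\lambda(A,B)\}$. For $\lambda\in\mathbb{D}$ and $a\in\overline{\mathbb{D}}$, define for $z\in\mathbb{D}$ $$\delta(z,\lambda)=\frac{z+\lambda}{1+\overline{\lambda}z},\qquad F_{a,\lambda}(z)=\int_0^z\bigl(1+B\zeta\,\delta(a\zeta,\lambda)\bigr)^{\frac{A-B}{B}}\,d\zeta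 .$$ *)

theory Defs
  imports "HOL-Complex_Analysis.Complex_Analysis"
begin

text \<open>
  Functions on the unit disc are total functions on the complex numbers of which only the
  values on the disc matter.
\<close>

abbreviation unit_disc :: "complex set" where
  "unit_disc \<equiv> ball 0 1"

definition schwarz_function :: "(complex \<Rightarrow> complex) \<Rightarrow> bool" where
  "schwarz_function \<xi> \<longleftrightarrow>
     \<xi> holomorphic_on unit_disc \<and> \<xi> ` unit_disc \<subseteq> unit_disc \<and> \<xi> 0 = 0"

definition subordinate :: "(complex \<Rightarrow> complex) \<Rightarrow> (complex \<Rightarrow> complex) \<Rightarrow> bool" where
  "subordinate h g \<longleftrightarrow> (\<exists>\<xi>. schwarz_function \<xi> \<and> (\<forall>z\<in>unit_disc. h z = g (\<xi> z)))"

text \<open>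
  The analytic branch of the logarithm of the derivative of \<open>f\<close> that vanishes at the origin.
  If \<open>f\<close> is holomorphic on the disc with nonvanishing derivative and derivative \<open>1\<close> at the
  origin, such a branch exists and is unique on the disc; otherwise the value is unspecified.
  It need not be the principal value of the logarithm of \<open>deriv f z\<close>.
\<close>

definition log_of_deriv :: "(complex \<Rightarrow> complex) \<Rightarrow> complex \<Rightarrow> complex" where
  "log_of_deriv f =
     (SOME L. L holomorphic_on unit_disc \<and> L 0 = 0 \<and> (\<forall>z\<in>unit_disc. exp (L z) = deriv f z))"

text \<open>
  For \<open>\<bar>B\<bar> \<le> 1\<close> and \<open>z\<close> in the disc, \<open>1 + B z\<close> lies in the disc of radius \<open>1\<close> about \<open>1\<close>, so the
  principal logarithm is the branch vanishing at \<open>z = 0\<close>.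
\<close>

definition class_C :: "real \<Rightarrow> real \<Rightarrow> (complex \<Rightarrow> complex) set" where
  "class_C A B = {f. f holomorphic_on unit_disc \<and> (\<forall>z\<in>unit_disc. deriv f z \<noteq> 0) \<and>
     f 0 = 0 \<and> deriv f 0 = 1 \<and>
     subordinate (log_of_deriv f) (\<lambda>z. of_real (A / B - 1) * Ln (1 + of_real B * z))}"

definition class_C_lam :: "complex \<Rightarrow> real \<Rightarrow> real \<Rightarrow> (complex \<Rightarrow> complex) set" where
  "class_C_lam lam A B = {f \<in> class_C A B. deriv (deriv f) 0 = lam * of_real (A - B)}"

definition V_region :: "complex \<Rightarrow> complex \<Rightarrow> real \<Rightarrow> real \<Rightarrow> complex set" where
  "V_region lam z0 A B = {log_of_deriv f z0 | f. f \<in> class_C_lam lam A B}"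

definition delta :: "complex \<Rightarrow> complex \<Rightarrow> complex" where
  "delta z lam = (z + lam) / (1 + cnj lam * z)"

text \<open>
  The integrand is holomorphic on the disc, so integrating along the segment from \<open>0\<close> to \<open>z\<close> is
  no restriction; the complex \<open>powr\<close> is formed with the principal logarithm.
\<close>

definition F_ext :: "real \<Rightarrow> real \<Rightarrow> complex \<Rightarrow> complex \<Rightarrow> complex \<Rightarrow> complex" where
  "F_ext A B a lam z = contour_integral (linepath 0 z)
     (\<lambda>\<zeta>. (1 + of_real B * \<zeta> * delta (a * \<zeta>) lam) powr of_real ((A - B) / B))"

definition c_center :: "real \<Rightarrow> complex \<Rightarrow> real \<Rightarrow> complex" where
  "c_center B z0 lam =
     (of_real (1 - lam\<^sup>2 * (cmod z0)\<^sup>2) + of_real (lam * B * (1 - (cmod z0)\<^sup>2)) * z0) /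
     of_real (1 - lam\<^sup>2 * (cmod z0)\<^sup>2)"

definition r_radius :: "real \<Rightarrow> complex \<Rightarrow> real \<Rightarrow> real" where
  "r_radius B z0 lam =
     \<bar>B\<bar> * (1 - lam\<^sup>2) * (cmod z0)\<^sup>2 / (1 - lam\<^sup>2 * (cmod z0)\<^sup>2)"

end

theory Submission
  imports Defs
begin

text \<open>
  A function in \<open>class_C_lam lam A B\<close> corresponds to a Schwarz function \<open>\<xi>\<close> with
  \<open>\<xi>'(0) = lam\<close>. By the Schwarz lemma \<open>\<xi> z = z \<delta>(\<omega> z, lam)\<close> for another Schwarz
  function \<open>\<omega>\<close>, so \<open>\<omega> z0 = a z0\<close> with \<open>\<bar>a\<bar> \<le> 1\<close>, and every such \<open>a\<close> occurs, for
  \<open>\<omega> z = a z\<close>, that is, for \<open>F_ext A B a lam\<close>. The Moebius map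
  \<open>w \<mapsto> 1 + B z0 \<delta>(w, lam)\<close> sends the disc \<open>\<bar>w\<bar> \<le> \<bar>z0\<bar>\<close> onto the disc with centre
  \<open>c\<close> and radius \<open>r\<close>, which lies in the right half plane, where the logarithm is a homeomorphism onto its
  image. A boundary value forces equality in the Schwarz lemma for \<open>\<omega>\<close>, hence \<open>\<omega> z = a z\<close> throughout.
\<close>

section \<open>The right half-plane and the disc automorphism \<open>delta\<close>\<close>

lemma cmod_of_real_mult_lt_1:
  assumes "\<bar>B\<bar> \<le> 1" "cmod u < 1"
  shows "cmod (of_real B * u) < 1"
proof -
  have "cmod (of_real B * u) \<le> 1 * cmod u"
    unfolding norm_mult using assms(1) by (intro mult_right_mono) auto
  then show ?thesis using assms(2) by simp
qed

text \<open>Keeps every such \<open>1 + B u\<close> off the branch cut of \<open>Ln\<close>, so that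
  composites with the principal logarithm are holomorphic.\<close>

lemma Re_one_plus_pos:
  assumes "\<bar>B\<bar> \<le> 1" "cmod u < 1"
  shows "0 < Re (1 + of_real B * u)"
  using cmod_of_real_mult_lt_1[OF assms] abs_Re_le_cmod[of "of_real B * u"] by (simp add: abs_le_iff)

lemma delta_eq_Moebius: "delta z lam = Moebius_function 0 (- lam) z"
  by (simp add: delta_def Moebius_function_simple)

lemma delta_zero [simp]: "delta 0 lam = lam"
  by (simp add: delta_def)

lemma delta_neg_self [simp]: "delta lam (- lam) = 0"
  by (simp add: delta_def)

lemma delta_norm_lt_1: "cmod z < 1 \<Longrightarrow> cmod lam < 1 \<Longrightarrow> cmod (delta z lam) < 1"
  by (simp add: delta_eq_Moebius Moebius_function_norm_lt_1)

lemma delta_holomorphic: "cmod lam < 1 \<Longrightarrow> (\<lambda>z. delta z lam) holomorphic_on unit_disc"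
  using Moebius_function_holomorphic[of "- lam" 0] by (simp add: delta_eq_Moebius)

lemma delta_inverse: "cmod z < 1 \<Longrightarrow> cmod lam < 1 \<Longrightarrow> delta (delta z (- lam)) lam = z"
  by (simp add: delta_eq_Moebius Moebius_function_compose)

lemma delta_inverse': "cmod z < 1 \<Longrightarrow> cmod lam < 1 \<Longrightarrow> delta (delta z lam) (- lam) = z"
  using delta_inverse[of z "- lam"] by simp

section \<open>Schwarz functions with prescribed derivative at the origin\<close>

lemma schwarz_function_norm_lt_1: "schwarz_function \<xi> \<Longrightarrow> cmod z < 1 \<Longrightarrow> cmod (\<xi> z) < 1"
  by (auto simp: schwarz_function_def image_subset_iff)

text \<open>The second-order Schwarz-Pick lemma: apply the Schwarz lemma to
  \<open>\<xi> z / z\<close> composed with the disc automorphism that moves \<open>lam\<close> to \<open>0\<close>.\<close>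

lemma schwarz_function_factor:
  assumes \<xi>: "schwarz_function \<xi>" and lam: "deriv \<xi> 0 = lam" "cmod lam < 1"
  obtains \<omega> where "schwarz_function \<omega>" "\<And>z. cmod z < 1 \<Longrightarrow> \<xi> z = z * delta (\<omega> z) lam"
proof -
  have hol: "\<xi> holomorphic_on ball 0 1" and \<xi>0: "\<xi> 0 = 0"
    and lt: "\<And>z. cmod z < 1 \<Longrightarrow> cmod (\<xi> z) < 1"
    using \<xi> schwarz_function_norm_lt_1 by (auto simp: schwarz_function_def)
  obtain \<phi> where \<phi>: "\<phi> holomorphic_on ball 0 1" "\<And>z. cmod z < 1 \<Longrightarrow> \<xi> z = z * \<phi> z" "deriv \<xi> 0 = \<phi> 0"
    using Schwarz3[OF hol \<xi>0] by metis
  have \<phi>_lt: "cmod (\<phi> z) < 1" if z: "cmod z < 1" for z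
  proof (cases "z = 0")
    case True
    then show ?thesis using \<phi>(3) lam by simp
  next
    case False
    have "cmod (\<xi> z) \<le> cmod z"
      using Schwarz_Lemma(1)[OF hol \<xi>0 lt z] .
    \<comment> \<open>Equality would make \<open>\<xi>\<close> a rotation and force
      \<open>cmod lam = 1\<close>. So the quotient \<open>\<phi>\<close> stays in the open disc,
      where \<open>delta\<close> can be inverted.\<close>
    moreover have "cmod (\<xi> z) \<noteq> cmod z"
    proof
      assume "cmod (\<xi> z) = cmod z"
      then obtain \<alpha> where \<alpha>: "\<And>z. cmod z < 1 \<Longrightarrow> \<xi> z = \<alpha> * z" "cmod \<alpha> = 1"
        using Schwarz_Lemma(3)[OF hol \<xi>0 lt, of 0] z False by auto
      have "(\<xi> has_field_derivative \<alpha>) (at 0)"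
      proof (rule has_field_derivative_transform_within_open[of "\<lambda>z. \<alpha> * z" _ _ "ball 0 1"])
        show "((*) \<alpha> has_field_derivative \<alpha>) (at 0)"
          by (auto intro!: derivative_eq_intros)
      qed (use \<alpha>(1) in auto)
      then show False
        using lam \<alpha>(2) DERIV_imp_deriv by fastforce
    qed
    ultimately have "cmod z * cmod (\<phi> z) < cmod z * 1"
      using \<phi>(2)[OF z] by (simp add: norm_mult)
    then show ?thesis using False by (simp add: mult_less_cancel_left)
  qed
  define \<omega> where "\<omega> z = delta (\<phi> z) (- lam)" for z
  have "(\<lambda>z. delta z (- lam)) \<circ> \<phi> holomorphic_on ball 0 1"
    by (rule holomorphic_on_compose_gen[OF \<phi>(1) delta_holomorphic]) (use lam \<phi>_lt in auto)
  then have "schwarz_function \<omega>"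
    using \<phi>(3) lam \<phi>_lt
    by (auto simp: schwarz_function_def \<omega>_def[abs_def] o_def intro!: delta_norm_lt_1)
  moreover have "\<xi> z = z * delta (\<omega> z) lam" if "cmod z < 1" for z
    using \<phi>(2) that \<phi>_lt lam by (simp add: \<omega>_def delta_inverse)
  ultimately show ?thesis using that by blast
qed

text \<open>The converse of the factorisation for \<open>\<omega> z = a * z\<close>, giving the
  Schwarz functions behind \<open>F_ext\<close>. At the origin the product rule leaves only
  \<open>delta 0 lam = lam\<close>, so the derivative of the second factor merely has to
  exist.\<close>

lemma schwarz_function_mult_delta:
  assumes lam: "cmod lam < 1" and a: "cmod a \<le> 1"
  shows "schwarz_function (\<lambda>z. z * delta (a * z) lam)"
    and "deriv (\<lambda>z. z * delta (a * z) lam) 0 = lam"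
proof -
  have az: "cmod (a * z) < 1" if "cmod z < 1" for z
  proof -
    have "cmod (a * z) \<le> 1 * cmod z"
      unfolding norm_mult using a by (intro mult_right_mono) auto
    then show ?thesis using that by simp
  qed
  have "(\<lambda>z. delta z lam) \<circ> (\<lambda>z. a * z) holomorphic_on ball 0 1"
    by (rule holomorphic_on_compose_gen[OF _ delta_holomorphic])
      (use lam az in \<open>auto intro!: holomorphic_intros\<close>)
  then have hol: "(\<lambda>z. delta (a * z) lam) holomorphic_on ball 0 1"
    by (simp add: o_def)
  have "cmod (z * delta (a * z) lam) < 1" if "cmod z < 1" for z
    using norm_mult_less[OF that delta_norm_lt_1[OF az[OF that] lam]] by simp
  then show "schwarz_function (\<lambda>z. z * delta (a * z) lam)"
    using hol by (auto simp: schwarz_function_def intro!: holomorphic_intros)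
  obtain D where "((\<lambda>z. delta (a * z) lam) has_field_derivative D) (at 0)"
    using holomorphic_on_imp_differentiable_at[OF hol, of 0] by (auto simp: field_differentiable_def)
  then have "((\<lambda>z. z * delta (a * z) lam) has_field_derivative lam) (at 0)"
    by (auto intro!: derivative_eq_intros)
  then show "deriv (\<lambda>z. z * delta (a * z) lam) 0 = lam"
    by (rule DERIV_imp_deriv)
qed

section \<open>The holomorphic branch of the logarithm of the derivative\<close>

text \<open>Differentiating \<open>exp L = exp M\<close> and cancelling the nonzero exponential
  shows that the derivatives agree. So \<open>L - M\<close> is constant on the connected set, and
  the constant is read off at \<open>a\<close>.\<close>

lemma holomorphic_exp_eq_unique:
  assumes "L holomorphic_on S" "M holomorphic_on S" "open S" "connected S" "a \<in> S"
    and "L a = M a" "\<And>z. z \<in> S \<Longrightarrow> exp (L z) = exp (M z)" "z \<in> S"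
  shows "L z = M z"
proof -
  have "((\<lambda>z. L z - M z) has_field_derivative 0) (at w)" if w: "w \<in> S" for w
  proof -
    have L: "(L has_field_derivative deriv L w) (at w)" and M: "(M has_field_derivative deriv M w) (at w)"
      using assms w by (auto intro!: holomorphic_derivI)
    have "((\<lambda>z. exp (L z)) has_field_derivative exp (L w) * deriv L w) (at w)"
      using L by (auto intro!: derivative_eq_intros)
    moreover have "((\<lambda>z. exp (L z)) has_field_derivative exp (M w) * deriv M w) (at w)"
      by (rule has_field_derivative_transform_within_open[of "\<lambda>z. exp (M z)" _ _ S])
        (use M assms w in \<open>auto intro!: derivative_eq_intros\<close>)
    ultimately have "deriv L w = deriv M w"
      using DERIV_unique assms(7)[OF w] by fastforce
    then show ?thesis using DERIV_diff[OF L M] by simp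
  qed
  then obtain c where "\<And>z. z \<in> S \<Longrightarrow> L z - M z = c"
    using DERIV_zero_connected_constant[of S "{}" "\<lambda>z. L z - M z"] assms
    by (metis Diff_empty finite.emptyI continuous_on_diff holomorphic_on_imp_continuous_on)
  then show ?thesis using assms by (metis eq_iff_diff_eq_0)
qed

text \<open>\<open>log_of_deriv\<close> is defined by choice, so its values are computed by
  exhibiting a candidate: \<open>M\<close> shows that the choice is realised, and uniqueness of the
  branch identifies the chosen function with \<open>M\<close> on the disc.\<close>

lemma log_of_deriv_eqI:
  assumes "M holomorphic_on unit_disc" "M 0 = 0" "\<And>z. z \<in> unit_disc \<Longrightarrow> exp (M z) = deriv f z"
    and z: "z \<in> unit_disc"
  shows "log_of_deriv f z = M z"
proof -
  let ?P = "\<lambda>L. L holomorphic_on unit_disc \<and> L 0 = 0 \<and> (\<forall>z\<in>unit_disc. exp (L z) = deriv f z)"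
  have P: "?P (log_of_deriv f)"
    unfolding log_of_deriv_def by (rule someI[of ?P M]) (use assms in auto)
  show ?thesis
  proof (rule holomorphic_exp_eq_unique[where L = "log_of_deriv f" and M = M and z = z and S = unit_disc and a = 0])
    show "log_of_deriv f holomorphic_on unit_disc" using P by blast
    show "M holomorphic_on unit_disc" by fact
    show "log_of_deriv f 0 = M 0" using P assms(2) by metis
    show "exp (log_of_deriv f w) = exp (M w)" if "w \<in> unit_disc" for w
      using P assms(3) that by metis
  qed (use z in auto)
qed

lemma exp_log_of_deriv:
  assumes f: "f holomorphic_on unit_disc" "\<And>z. z \<in> unit_disc \<Longrightarrow> deriv f z \<noteq> 0" "deriv f 0 = 1"
    and z: "z \<in> unit_disc"
  shows "exp (log_of_deriv f z) = deriv f z"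
proof -
  have "deriv f holomorphic_on unit_disc"
    using f(1) by (intro holomorphic_deriv) auto
  then obtain g where g: "g holomorphic_on unit_disc" "\<And>z. z \<in> unit_disc \<Longrightarrow> exp (g z) = deriv f z"
    using contractible_imp_holomorphic_log[of "deriv f" unit_disc] f(2) convex_imp_contractible[of unit_disc]
    by (metis convex_ball)
  \<comment> \<open>\<open>g 0\<close> may be any multiple of \<open>2 pi i\<close>. Since
    \<open>exp (g 0) = deriv f 0 = 1\<close>, subtracting it normalises the branch without changing
    its exponential.\<close>
  have "log_of_deriv f z = g z - g 0"
    by (rule log_of_deriv_eqI)
      (use g f(3) g(2)[of 0] z in \<open>auto intro!: holomorphic_intros simp: exp_diff\<close>)
  then show ?thesis
    using g(2)[of 0] g(2)[OF z] f(3) by (simp add: exp_diff)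
qed

section \<open>Membership in the class in terms of Schwarz functions\<close>

lemma holomorphic_on_Ln_schwarz:
  assumes "\<bar>B\<bar> \<le> 1" "schwarz_function \<xi>"
  shows "(\<lambda>z. k * Ln (1 + of_real B * \<xi> z)) holomorphic_on unit_disc"
proof -
  have "1 + of_real B * \<xi> z \<notin> \<real>\<^sub>\<le>\<^sub>0" if "z \<in> unit_disc" for z
    using Re_one_plus_pos[OF assms(1) schwarz_function_norm_lt_1[OF assms(2)], of z] that
    by (simp add: complex_nonpos_Reals_iff)
  then show ?thesis
    using assms(2) by (auto simp: schwarz_function_def intro!: holomorphic_intros)
qed

text \<open>Translates the condition on the second derivative of \<open>f\<close> into one on
  \<open>deriv \<xi> 0\<close>. Because \<open>\<xi> 0 = 0\<close>, the exponential and the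
  derivative of \<open>Ln\<close> both equal 1 at the origin, so the chain rule leaves only
  constants.\<close>

lemma deriv2_of_exp_Ln:
  assumes "schwarz_function \<xi>"
    and "\<And>z. z \<in> unit_disc \<Longrightarrow> deriv f z = exp (k * Ln (1 + of_real B * \<xi> z))"
  shows "deriv (deriv f) 0 = k * of_real B * deriv \<xi> 0"
proof -
  have 0: "\<xi> 0 = 0" using assms by (auto simp: schwarz_function_def)
  have "(\<xi> has_field_derivative deriv \<xi> 0) (at 0)"
    using assms(1) unfolding schwarz_function_def by (intro holomorphic_derivI[of _ unit_disc]) auto
  then have "((\<lambda>z. exp (k * Ln (1 + of_real B * \<xi> z))) has_field_derivative
      k * of_real B * deriv \<xi> 0) (at 0)"
    using 0 by (auto intro!: derivative_eq_intros)
  then have "(deriv f has_field_derivative k * of_real B * deriv \<xi> 0) (at 0)"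
    by (rule has_field_derivative_transform_within_open[of _ _ _ unit_disc]) (use assms in auto)
  then show ?thesis by (rule DERIV_imp_deriv)
qed

lemma class_C_lamE:
  assumes f: "f \<in> class_C_lam lam A B" and AB: "A \<noteq> B" "B \<noteq> 0"
  obtains \<xi> where "schwarz_function \<xi>" "deriv \<xi> 0 = lam"
    "\<And>z. z \<in> unit_disc \<Longrightarrow> log_of_deriv f z = of_real ((A - B) / B) * Ln (1 + of_real B * \<xi> z)"
    "\<And>z. z \<in> unit_disc \<Longrightarrow> deriv f z = exp (log_of_deriv f z)"
proof -
  have k: "A / B - 1 = (A - B) / B" using AB by (simp add: field_simps)
  obtain \<xi> where \<xi>: "schwarz_function \<xi>"
    "\<And>z. z \<in> unit_disc \<Longrightarrow> log_of_deriv f z = of_real ((A - B) / B) * Ln (1 + of_real B * \<xi> z)"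
    using f unfolding class_C_lam_def class_C_def subordinate_def k by blast
  have e: "deriv f z = exp (log_of_deriv f z)" if "z \<in> unit_disc" for z
    using f exp_log_of_deriv[of f z] that by (auto simp: class_C_lam_def class_C_def)
  have "deriv (deriv f) 0 = of_real ((A - B) / B) * of_real B * deriv \<xi> 0"
    by (rule deriv2_of_exp_Ln) (use \<xi> e in auto)
  moreover have "deriv (deriv f) 0 = lam * of_real (A - B)"
    using f by (simp add: class_C_lam_def)
  moreover have "of_real ((A - B) / B) * of_real B = (of_real (A - B) :: complex)"
    unfolding of_real_mult[symmetric] using AB by simp
  ultimately have "of_real (A - B) * deriv \<xi> 0 = of_real (A - B) * lam"
    by (metis mult.commute)
  then have "deriv \<xi> 0 = lam" using AB by (simp flip: of_real_diff)
  with \<xi> e show ?thesis using that by blast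
qed

text \<open>The formula for \<open>log_of_deriv f\<close> is proved first, since the subordination
  in \<open>class_C\<close> speaks of that chosen branch. The exponential form of the derivative
  also yields its nonvanishing and its value 1 at the origin.\<close>

lemma class_C_lamI:
  assumes AB: "A \<noteq> B" "B \<noteq> 0" "\<bar>B\<bar> \<le> 1"
    and f: "f holomorphic_on unit_disc" "f 0 = 0"
    and \<xi>: "schwarz_function \<xi>" "deriv \<xi> 0 = lam"
    and e: "\<And>z. z \<in> unit_disc \<Longrightarrow> deriv f z = exp (of_real ((A - B) / B) * Ln (1 + of_real B * \<xi> z))"
  shows "f \<in> class_C_lam lam A B"
    and "\<And>z. z \<in> unit_disc \<Longrightarrow> log_of_deriv f z = of_real ((A - B) / B) * Ln (1 + of_real B * \<xi> z)"
proof -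
  have k: "A / B - 1 = (A - B) / B" using AB by (simp add: field_simps)
  have 0: "\<xi> 0 = 0" using \<xi> by (auto simp: schwarz_function_def)
  show l: "log_of_deriv f z = of_real ((A - B) / B) * Ln (1 + of_real B * \<xi> z)" if "z \<in> unit_disc" for z
    by (rule log_of_deriv_eqI)
      (use that e 0 AB \<xi> in \<open>auto intro!: holomorphic_on_Ln_schwarz simp del: of_real_divide of_real_diff\<close>)
  have "deriv (deriv f) 0 = of_real ((A - B) / B) * of_real B * deriv \<xi> 0"
    by (rule deriv2_of_exp_Ln) (use \<xi> e in auto)
  then show "f \<in> class_C_lam lam A B"
    using f \<xi> AB l e e[of 0] 0 unfolding class_C_lam_def class_C_def subordinate_def k
    by auto
qed

section \<open>The extremal functions \<open>F_ext\<close>\<close>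

text \<open>On the convex disc the holomorphic integrand has a primitive \<open>P\<close>, and the
  segment integral equals \<open>P z - P 0\<close>.\<close>

lemma F_ext_deriv:
  assumes B: "\<bar>B\<bar> \<le> 1" and lam: "cmod lam < 1" and a: "cmod a \<le> 1"
  shows "F_ext A B a lam holomorphic_on unit_disc"
    and "\<And>z. z \<in> unit_disc \<Longrightarrow> deriv (F_ext A B a lam) z =
        exp (of_real ((A - B) / B) * Ln (1 + of_real B * (z * delta (a * z) lam)))"
proof -
  let ?\<xi> = "\<lambda>z. z * delta (a * z) lam"
  let ?G = "\<lambda>z. (1 + of_real B * z * delta (a * z) lam) powr of_real ((A - B) / B)"
  let ?E = "\<lambda>z. exp (of_real ((A - B) / B) * Ln (1 + of_real B * ?\<xi> z))"
  note \<xi> = schwarz_function_mult_delta(1)[OF lam a]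
  \<comment> \<open>Complex \<open>powr\<close> takes the value 0 at base 0, so the passage to the
    exponential form needs a nonzero base.\<close>
  have GE: "?G z = ?E z" if "z \<in> unit_disc" for z
  proof -
    have "1 + of_real B * ?\<xi> z \<noteq> 0"
      using Re_one_plus_pos[OF B, of "?\<xi> z"] \<xi> that by (force simp: schwarz_function_def)
    then show ?thesis by (simp add: powr_def mult.assoc)
  qed
  have "?E holomorphic_on unit_disc"
    by (intro holomorphic_on_exp' holomorphic_on_Ln_schwarz B \<xi>)
  then have "?G holomorphic_on unit_disc"
    by (rule holomorphic_transform) (use GE in auto)
  then obtain P where P: "\<And>z. z \<in> unit_disc \<Longrightarrow> (P has_field_derivative ?G z) (at z within unit_disc)"
    using holomorphic_convex_primitive'[of unit_disc ?G] by (metis convex_ball open_ball)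
  have F: "F_ext A B a lam z = P z - P 0" if z: "z \<in> unit_disc" for z
  proof -
    have "path_image (linepath 0 z) \<subseteq> unit_disc"
      unfolding path_image_linepath using z by (intro closed_segment_subset) auto
    then have "(?G has_contour_integral P (pathfinish (linepath 0 z)) - P (pathstart (linepath 0 z))) (linepath 0 z)"
      by (intro contour_integral_primitive[where S = unit_disc and f = P] P valid_path_linepath)
    then show ?thesis
      unfolding F_ext_def pathfinish_linepath pathstart_linepath by (rule contour_integral_unique)
  qed
  have D: "(F_ext A B a lam has_field_derivative ?E z) (at z)" if z: "z \<in> unit_disc" for z
  proof (rule has_field_derivative_transform_within_open[of "\<lambda>z. P z - P 0" _ _ unit_disc])
    have "(P has_field_derivative ?G z) (at z)"
      using P[OF z] unfolding at_within_open[OF z open_ball] .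
    from DERIV_diff[OF this DERIV_const[of "P 0"]]
    show "((\<lambda>z. P z - P 0) has_field_derivative ?E z) (at z)"
      unfolding GE[OF z] diff_zero .
    show "P w - P 0 = F_ext A B a lam w" if "w \<in> unit_disc" for w
      using F[OF that] by (rule sym)
  qed (use z in auto)
  show "F_ext A B a lam holomorphic_on unit_disc"
    unfolding holomorphic_on_open[OF open_ball] using D by blast
  show "deriv (F_ext A B a lam) z = ?E z" if "z \<in> unit_disc" for z
    using D[OF that] by (rule DERIV_imp_deriv)
qed

lemma F_ext_in_class_C_lam:
  assumes AB: "A \<noteq> B" "B \<noteq> 0" "\<bar>B\<bar> \<le> 1" and lam: "cmod lam < 1" and a: "cmod a \<le> 1"
  shows "F_ext A B a lam \<in> class_C_lam lam A B"
    and "z \<in> unit_disc \<Longrightarrow> log_of_deriv (F_ext A B a lam) z =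
        of_real ((A - B) / B) * Ln (1 + of_real B * (z * delta (a * z) lam))"
proof -
  have 0: "F_ext A B a lam 0 = 0" by (simp add: F_ext_def)
  note * = F_ext_deriv[OF AB(3) lam a, where A = A] schwarz_function_mult_delta[OF lam a]
  show "F_ext A B a lam \<in> class_C_lam lam A B"
    by (rule class_C_lamI(1)[OF AB *(1) 0 *(3,4,2)])
  show "z \<in> unit_disc \<Longrightarrow> log_of_deriv (F_ext A B a lam) z =
        of_real ((A - B) / B) * Ln (1 + of_real B * (z * delta (a * z) lam))"
    by (rule class_C_lamI(2)[OF AB *(1) 0 *(3,4,2)])
qed

section \<open>Boundaries of injective images\<close>

text \<open>It suffices that \<open>g\<close> carries interior onto interior, as both sets are
  closed. Invariance of domain makes the image of \<open>interior K\<close> open. Conversely the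
  preimage of the interior of the image is open by continuity and lies in \<open>K\<close> by
  injectivity on all of \<open>S\<close>.\<close>

lemma frontier_inj_image_compact:
  fixes g :: "'a::euclidean_space \<Rightarrow> 'a"
  assumes "open S" "continuous_on S g" "inj_on g S" "compact K" "K \<subseteq> S"
  shows "frontier (g ` K) = g ` frontier K"
proof -
  have "interior (g ` K) = g ` interior K"
  proof (intro equalityI subsetI)
    fix y assume y: "y \<in> interior (g ` K)"
    then obtain x where x: "x \<in> K" "y = g x" using interior_subset by blast
    have "open (S \<inter> g -` interior (g ` K))"
      using assms by (intro continuous_open_preimage) auto
    moreover have "S \<inter> g -` interior (g ` K) \<subseteq> K"
    proof
      fix w assume w: "w \<in> S \<inter> g -` interior (g ` K)"
      then obtain v where "v \<in> K" "g w = g v" using interior_subset by blast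
      then show "w \<in> K" using w assms(3,5) by (metis IntD1 inj_onD subsetD)
    qed
    ultimately have "x \<in> interior K"
      using x y assms(5) by (intro interiorI) auto
    then show "y \<in> g ` interior K" using x by blast
  next
    fix y assume "y \<in> g ` interior K"
    moreover have "interior K \<subseteq> S" using interior_subset assms(5) by blast
    then have "open (g ` interior K)"
      using assms by (intro invariance_of_domain_gen) (auto intro: continuous_on_subset inj_on_subset)
    ultimately show "y \<in> interior (g ` K)"
      using interior_subset[of K] by (intro interiorI) auto
  qed
  moreover have "closed (g ` K)"
    using assms by (intro compact_imp_closed compact_continuous_image) (auto intro: continuous_on_subset)
  moreover have "g ` (K - interior K) = g ` K - g ` interior K"
    using assms(3,5) interior_subset[of K] by (intro inj_on_image_set_diff[of g S]) auto
  ultimately show ?thesis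
    using assms(4) by (simp add: frontier_def compact_imp_closed)
qed

section \<open>The Moebius image of the disc of radius \<open>cmod z0\<close>\<close>

context
  fixes B lam :: real and z0 :: complex
  assumes B: "B \<noteq> 0" and lam: "0 \<le> lam" "lam < 1" and z0: "cmod z0 < 1" "z0 \<noteq> 0"
begin

lemma lam_norm_z0_lt_1: "lam * cmod z0 < 1" "lam\<^sup>2 * (cmod z0)\<^sup>2 < 1"
proof -
  show 1: "lam * cmod z0 < 1"
    using mult_strict_mono[of lam 1 "cmod z0" 1] lam z0 by simp
  show "lam\<^sup>2 * (cmod z0)\<^sup>2 < 1"
    using power_strict_mono[OF 1, of 2] lam by (simp add: power_mult_distrib)
qed

lemma r_radius_pos: "0 < r_radius B z0 lam"
proof -
  have "lam\<^sup>2 < 1" using lam by (simp add: abs_square_less_1)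
  then show ?thesis
    using B z0 lam_norm_z0_lt_1 unfolding r_radius_def
    by (intro divide_pos_pos mult_pos_pos) auto
qed

text \<open>The fraction vanishes at \<open>w = - lam * (cmod z0)\<^sup>2\<close>, the reflection of
  the pole \<open>- 1 / lam\<close> in the circle of radius \<open>cmod z0\<close> (the origin and
  infinity if \<open>lam = 0\<close>). A Moebius map preserves symmetric points, so this point goes
  to the centre of the image disc.\<close>

lemma delta_image_minus_center:
  assumes w: "cmod w < 1"
  shows "1 + of_real B * (z0 * delta w (of_real lam)) - c_center B z0 lam =
    of_real (B * (1 - lam\<^sup>2) / (1 - lam\<^sup>2 * (cmod z0)\<^sup>2)) * z0 *
      ((w + of_real (lam * (cmod z0)\<^sup>2)) / (1 + of_real lam * w))"
proof -
  define \<rho> where "\<rho> = (cmod z0)\<^sup>2"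
  have "lam\<^sup>2 * \<rho> < 1" using lam_norm_z0_lt_1 by (simp add: \<rho>_def)
  then have "of_real (1 - lam\<^sup>2 * \<rho>) \<noteq> (0::complex)" by (simp del: of_real_diff)
  moreover have "cmod (of_real lam * w) < 1"
    using cmod_of_real_mult_lt_1[of lam w] lam w by simp
  then have "1 + of_real lam * w \<noteq> 0"
    by (metis add_eq_0_iff norm_minus_cancel norm_one order_less_irrefl)
  ultimately show ?thesis
    unfolding delta_def c_center_def \<rho>_def[symmetric]
    by (simp add: divide_simps) algebra
qed

text \<open>As the first factor on the right is positive, comparing the modulus of the fraction
  above with \<open>cmod z0\<close> amounts to comparing \<open>cmod w\<close> with
  \<open>cmod z0\<close>.\<close>

lemma norm_add_moebius:
  "(cmod (w + of_real (lam * (cmod z0)\<^sup>2)))\<^sup>2 - (cmod z0)\<^sup>2 * (cmod (1 + of_real lam * w))\<^sup>2 =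
    (1 - lam\<^sup>2 * (cmod z0)\<^sup>2) * ((cmod w)\<^sup>2 - (cmod z0)\<^sup>2)"
proof -
  define \<rho> where "\<rho> = (cmod z0)\<^sup>2"
  have "(Re w + lam * \<rho>)\<^sup>2 + (Im w)\<^sup>2 - \<rho> * ((1 + lam * Re w)\<^sup>2 + (lam * Im w)\<^sup>2) =
     (1 - lam\<^sup>2 * \<rho>) * ((Re w)\<^sup>2 + (Im w)\<^sup>2 - \<rho>)"
    by algebra
  then show ?thesis
    unfolding \<rho>_def[symmetric] by (simp add: cmod_power2)
qed

text \<open>The distance is \<open>k * (X / Y)\<close> and the radius is \<open>k * cmod z0\<close>
  with the same \<open>k > 0\<close>, so both equivalences are sign questions for the preceding
  identity.\<close>

lemma dist_delta_image_center:
  assumes w: "cmod w < 1"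
  shows "dist (c_center B z0 lam) (1 + of_real B * (z0 * delta w (of_real lam))) \<le> r_radius B z0 lam
      \<longleftrightarrow> cmod w \<le> cmod z0"
    and "dist (c_center B z0 lam) (1 + of_real B * (z0 * delta w (of_real lam))) = r_radius B z0 lam
      \<longleftrightarrow> cmod w = cmod z0"
proof -
  let ?q = "1 - lam\<^sup>2 * (cmod z0)\<^sup>2"
  define k where "k = \<bar>B\<bar> * (1 - lam\<^sup>2) * cmod z0 / ?q"
  define X where "X = cmod (w + of_real (lam * (cmod z0)\<^sup>2))"
  define Y where "Y = cmod (1 + of_real lam * w)"
  have q: "?q > 0" using lam_norm_z0_lt_1 by simp
  have l: "lam\<^sup>2 < 1" using lam by (simp add: abs_square_less_1)
  have k: "k > 0"
    using q B z0 l unfolding k_def by (intro divide_pos_pos mult_pos_pos) auto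
  have "cmod (of_real lam * w) < 1"
    using cmod_of_real_mult_lt_1[of lam w] lam w by simp
  then have "1 + of_real lam * w \<noteq> 0"
    by (metis add_eq_0_iff norm_minus_cancel norm_one order_less_irrefl)
  then have Y: "Y > 0" by (simp add: Y_def)
  have d: "dist (c_center B z0 lam) (1 + of_real B * (z0 * delta w (of_real lam))) = k * (X / Y)"
  proof -
    have *: "\<bar>B * (1 - lam\<^sup>2) / ?q\<bar> * cmod z0 = k"
      using q l by (simp add: k_def abs_mult)
    have "dist (c_center B z0 lam) p = cmod (p - c_center B z0 lam)" for p
      by (metis dist_commute dist_norm)
    then show ?thesis
      by (simp only: delta_image_minus_center[OF w] norm_mult norm_divide norm_of_real X_def Y_def *)
  qed
  have r: "r_radius B z0 lam = k * cmod z0"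
    by (simp add: r_radius_def k_def power2_eq_square)
  have *: "X\<^sup>2 - (cmod z0 * Y)\<^sup>2 = ?q * ((cmod w)\<^sup>2 - (cmod z0)\<^sup>2)"
    using norm_add_moebius[of w] by (simp add: X_def Y_def power_mult_distrib)
  have X: "X \<ge> 0" by (simp add: X_def)
  have "X / Y \<le> cmod z0 \<longleftrightarrow> X\<^sup>2 \<le> (cmod z0 * Y)\<^sup>2"
    using X Y by (simp add: divide_le_eq abs_le_square_iff[symmetric])
  also have "\<dots> \<longleftrightarrow> ?q * ((cmod w)\<^sup>2 - (cmod z0)\<^sup>2) \<le> 0"
    using * by linarith
  also have "\<dots> \<longleftrightarrow> cmod w \<le> cmod z0"
    using q by (simp add: mult_le_0_iff abs_le_square_iff[symmetric])
  finally show "dist (c_center B z0 lam) (1 + of_real B * (z0 * delta w (of_real lam))) \<le> r_radius B z0 lam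
      \<longleftrightarrow> cmod w \<le> cmod z0"
    unfolding d r mult_le_cancel_left_pos[OF k] .
  have "X / Y = cmod z0 \<longleftrightarrow> X\<^sup>2 = (cmod z0 * Y)\<^sup>2"
    using X Y by (simp add: divide_eq_eq power2_eq_iff_nonneg)
  also have "\<dots> \<longleftrightarrow> ?q * ((cmod w)\<^sup>2 - (cmod z0)\<^sup>2) = 0"
    using * by linarith
  also have "\<dots> \<longleftrightarrow> cmod w = cmod z0"
    using q by simp
  finally show "dist (c_center B z0 lam) (1 + of_real B * (z0 * delta w (of_real lam))) = r_radius B z0 lam
      \<longleftrightarrow> cmod w = cmod z0"
    unfolding d r using k by (simp del: times_divide_eq_right)
qed

text \<open>Surjectivity of the parametrisation. To invert \<open>delta\<close>, the quotient
  \<open>(p - 1) / (B * z0)\<close> must lie in the open unit disc. The triangle inequality through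
  the centre bounds its modulus by \<open>(lam + \<rho>) / (1 + lam * \<rho>)\<close>, which is
  below 1.\<close>

lemma cball_center_cases:
  assumes p: "p \<in> cball (c_center B z0 lam) (r_radius B z0 lam)"
  obtains a where "cmod a \<le> 1" "p = 1 + of_real B * (z0 * delta (a * z0) (of_real lam))"
proof -
  define \<rho> where "\<rho> = cmod z0"
  have \<rho>: "0 < \<rho>" "\<rho> < 1" using z0 by (auto simp: \<rho>_def)
  have q: "lam * \<rho> < 1" "1 - lam\<^sup>2 * \<rho>\<^sup>2 > 0" using lam_norm_z0_lt_1 by (auto simp: \<rho>_def)
  have "c_center B z0 lam - 1 = of_real (lam * B * (1 - \<rho>\<^sup>2) / (1 - lam\<^sup>2 * \<rho>\<^sup>2)) * z0"
    using q(2) unfolding c_center_def \<rho>_def[symmetric]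
    by (simp add: add_divide_distrib del: of_real_diff)
  then have "dist (c_center B z0 lam) 1 = \<bar>lam * B * (1 - \<rho>\<^sup>2) / (1 - lam\<^sup>2 * \<rho>\<^sup>2)\<bar> * \<rho>"
    by (simp only: dist_norm norm_mult norm_of_real \<rho>_def)
  also have "\<dots> = \<bar>B\<bar> * lam * (1 - \<rho>\<^sup>2) / (1 - lam\<^sup>2 * \<rho>\<^sup>2) * \<rho>"
    using q(2) lam \<rho> by (simp add: abs_mult power_le_one)
  finally have "dist (c_center B z0 lam) 1 = \<bar>B\<bar> * lam * (1 - \<rho>\<^sup>2) / (1 - lam\<^sup>2 * \<rho>\<^sup>2) * \<rho>" .
  then have "dist p 1 \<le> \<bar>B\<bar> * lam * (1 - \<rho>\<^sup>2) / (1 - lam\<^sup>2 * \<rho>\<^sup>2) * \<rho> + r_radius B z0 lam"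
    using p dist_triangle[of p 1 "c_center B z0 lam"] by (simp add: dist_commute)
  \<comment> \<open>Numerator and denominator share the factor
    \<open>1 - lam * \<rho>\<close>.\<close>
  also have "\<dots> = \<bar>B\<bar> * \<rho> * ((lam + \<rho>) / (1 + lam * \<rho>))"
  proof -
    have "lam * (1 - \<rho>\<^sup>2) + (1 - lam\<^sup>2) * \<rho> = (lam + \<rho>) * (1 - lam * \<rho>)"
      "1 - lam\<^sup>2 * \<rho>\<^sup>2 = (1 + lam * \<rho>) * (1 - lam * \<rho>)"
      by algebra+
    moreover have "1 - lam * \<rho> \<noteq> 0" using q(1) by simp
    ultimately have "(lam + \<rho>) / (1 + lam * \<rho>) =
        (lam * (1 - \<rho>\<^sup>2) + (1 - lam\<^sup>2) * \<rho>) / (1 - lam\<^sup>2 * \<rho>\<^sup>2)"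
      by simp
    then show ?thesis
      unfolding r_radius_def \<rho>_def[symmetric]
      by (simp add: add_divide_distrib distrib_left power2_eq_square mult_ac)
  qed
  also have "\<dots> < \<bar>B\<bar> * \<rho> * 1"
  proof (intro mult_strict_left_mono)
    have "0 < (1 - lam) * (1 - \<rho>)" using lam \<rho> by simp
    then have "lam + \<rho> < 1 + lam * \<rho>" by (simp add: algebra_simps)
    then show "(lam + \<rho>) / (1 + lam * \<rho>) < 1"
      using lam \<rho> by (simp add: divide_less_eq add_pos_nonneg)
  qed (use B \<rho> in auto)
  finally have p1: "cmod (p - 1) < cmod (of_real B * z0)"
    by (simp add: dist_norm norm_mult \<rho>_def)
  define u where "u = (p - 1) / (of_real B * z0)"
  have u: "cmod u < 1" "p = 1 + of_real B * (z0 * u)"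
    using p1 B z0 by (auto simp: u_def norm_divide)
  define w where "w = delta u (- of_real lam)"
  have w: "cmod w < 1" "u = delta w (of_real lam)"
    using u lam by (auto simp: w_def delta_inverse intro!: delta_norm_lt_1)
  \<comment> \<open>So far \<open>w\<close> is only known to lie in the unit disc; the distance
    criterion confines it to the smaller disc, so that \<open>a = w / z0\<close> is
    admissible.\<close>
  then have "cmod w \<le> cmod z0"
    using p u dist_delta_image_center(1)[OF w(1)] by simp
  then show ?thesis
    using that[of "w / z0"] u w z0 by (simp add: norm_divide)
qed

lemma norm_mult_z0_lt_1: "cmod a \<le> 1 \<Longrightarrow> cmod (a * z0) < 1"
  using mult_right_mono[of "cmod a" 1 "cmod z0", OF _ norm_ge_zero] z0 unfolding norm_mult by linarith

lemma cball_center_eq: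
  "cball (c_center B z0 lam) (r_radius B z0 lam) =
    (\<lambda>a. 1 + of_real B * (z0 * delta (a * z0) (of_real lam))) ` {a. cmod a \<le> 1}"
proof -
  have "1 + of_real B * (z0 * delta (a * z0) (of_real lam)) \<in> cball (c_center B z0 lam) (r_radius B z0 lam)"
    if "cmod a \<le> 1" for a
    using dist_delta_image_center(1)[OF norm_mult_z0_lt_1[OF that]] that z0
    by (simp add: norm_mult mult_le_cancel_right1)
  then show ?thesis by (auto elim!: cball_center_cases simp del: mem_cball)
qed

lemma sphere_center_eq:
  "sphere (c_center B z0 lam) (r_radius B z0 lam) =
    (\<lambda>a. 1 + of_real B * (z0 * delta (a * z0) (of_real lam))) ` {a. cmod a = 1}"
proof -
  have *: "1 + of_real B * (z0 * delta (a * z0) (of_real lam)) \<in> sphere (c_center B z0 lam) (r_radius B z0 lam)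
      \<longleftrightarrow> cmod a = 1" if "cmod a \<le> 1" for a
    using dist_delta_image_center(2)[OF norm_mult_z0_lt_1[OF that]] that z0
    by (simp add: norm_mult)
  show ?thesis
  proof (intro equalityI subsetI)
    fix p assume p: "p \<in> sphere (c_center B z0 lam) (r_radius B z0 lam)"
    then have "p \<in> cball (c_center B z0 lam) (r_radius B z0 lam)" by simp
    then show "p \<in> (\<lambda>a. 1 + of_real B * (z0 * delta (a * z0) (of_real lam))) ` {a. cmod a = 1}"
      using p * by (elim cball_center_cases) blast
  qed (use * in auto)
qed

end

section \<open>Parametrising the circle and closed simple curves\<close>

lemma cis_image: "cis ` {-pi<..pi} = {a. cmod a = 1}"
proof -
  have "a \<in> cis ` {-pi<..pi}" if "cmod a = 1" for a
    using cis_Arg[of a] Arg_bounded[of a] that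
    by (intro image_eqI[of _ _ "Arg a"]) (force simp: sgn_div_norm)+
  then show ?thesis by auto
qed

lemma inj_on_cis: "inj_on cis {-pi<..pi}"
  by (metis Arg_cis inj_on_inverseI)

lemma simple_path_cis_compose:
  assumes "continuous_on {a. cmod a = 1} g" "inj_on g {a. cmod a = 1}"
  shows "simple_path ((\<lambda>\<theta>. g (cis \<theta>)) \<circ> linepath (- pi) pi)"
proof -
  define h where "h t = cis (linepath (- pi) pi t)" for t
  have "continuous_on {0..1} h"
    unfolding h_def linepath_def by (intro continuous_intros)
  then have "path (g \<circ> h)"
    unfolding path_def
    by (intro continuous_on_compose continuous_on_subset[OF assms(1)]) (auto simp: h_def)
  moreover have "loop_free (g \<circ> h)"
    unfolding loop_free_def
  proof (intro ballI impI)
    fix x y :: real assume xy: "x \<in> {0..1}" "y \<in> {0..1}" "(g \<circ> h) x = (g \<circ> h) y"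
    then have hxy: "h x = h y"
      using inj_onD[OF assms(2), of "h x" "h y"] by (simp add: h_def)
    have lin: "linepath (- pi) pi t = pi * (2 * t - 1)" for t
      by (simp add: linepath_def algebra_simps)
    have mem: "linepath (- pi) pi t \<in> {- pi<..pi}" if "0 < t" "t \<le> 1" for t
    proof -
      have "pi * (2 * t - 1) > pi * (-1)" using that by (intro mult_strict_left_mono) auto
      moreover have "pi * (2 * t - 1) \<le> pi * 1" using that by (intro mult_left_mono) auto
      ultimately show ?thesis unfolding lin by simp
    qed
    have eq: "s = t" if st: "0 < s" "s \<le> 1" "0 < t" "t \<le> 1" and h: "h s = h t" for s t
    proof -
      have "linepath (- pi) pi s = linepath (- pi) pi t"
        by (rule inj_onD[OF inj_on_cis h[unfolded h_def] mem mem]) (use st in auto)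
      then show ?thesis by (simp add: lin)
    qed
    \<comment> \<open>Parameter 0 corresponds to \<open>- pi\<close>, outside the half-open interval
      where \<open>cis\<close> is injective. Trading it for parameter 1 reduces the endpoint cases
      to \<open>eq\<close> and leaves the one coincidence that \<open>loop_free\<close>
      permits.\<close>
    have h0: "h 0 = h 1" by (simp add: h_def linepath_def complex_eq_iff)
    have "x \<le> 1" "y \<le> 1" and pos: "x \<noteq> 0 \<Longrightarrow> 0 < x" "y \<noteq> 0 \<Longrightarrow> 0 < y"
      using xy(1,2) by auto
    then have "x = y" if "x \<noteq> 0" "y \<noteq> 0" using eq[of x y] hxy that by blast
    moreover have "x = 1" if "x \<noteq> 0" "y = 0"
      using eq[of x 1] pos(1)[OF that(1)] \<open>x \<le> 1\<close> hxy that(2) h0 by simp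
    moreover have "y = 1" if "y \<noteq> 0" "x = 0"
      using eq[of 1 y] pos(2)[OF that(1)] \<open>y \<le> 1\<close> hxy that(2) h0 by simp
    ultimately show "x = y \<or> x = 0 \<and> y = 1 \<or> x = 1 \<and> y = 0"
      by blast
  qed
  moreover have "(\<lambda>\<theta>. g (cis \<theta>)) \<circ> linepath (- pi) pi = g \<circ> h"
    by (simp add: h_def o_def)
  ultimately show ?thesis by (simp add: simple_path_def)
qed

lemma inj_on_Ln: "inj_on Ln (- {0})"
  by (metis ComplD exp_Ln inj_on_inverseI insertI1)

section \<open>Uniqueness at boundary values\<close>

lemma class_C_lam_eq_F_ext:
  assumes AB: "A \<noteq> B" "B \<noteq> 0" "\<bar>B\<bar> \<le> 1"
    and lam: "cmod lam < 1" and z0: "z0 \<in> unit_disc" "z0 \<noteq> 0" and a: "cmod a = 1"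
    and f: "f \<in> class_C_lam lam A B"
    and eq: "log_of_deriv f z0 = log_of_deriv (F_ext A B a lam) z0"
    and z: "z \<in> unit_disc"
  shows "f z = F_ext A B a lam z"
proof -
  let ?F = "F_ext A B a lam"
  have a': "cmod a \<le> 1" using a by simp
  note F = F_ext_in_class_C_lam[OF AB lam a'] F_ext_deriv[OF AB(3) lam a', where A = A]
  obtain \<xi> where \<xi>: "schwarz_function \<xi>" "deriv \<xi> 0 = lam"
    "\<And>z. z \<in> unit_disc \<Longrightarrow> log_of_deriv f z = of_real ((A - B) / B) * Ln (1 + of_real B * \<xi> z)"
    "\<And>z. z \<in> unit_disc \<Longrightarrow> deriv f z = exp (log_of_deriv f z)"
    using class_C_lamE[OF f AB(1,2)] by metis
  obtain \<omega> where \<omega>: "schwarz_function \<omega>" "\<And>z. cmod z < 1 \<Longrightarrow> \<xi> z = z * delta (\<omega> z) lam"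
    using schwarz_function_factor[OF \<xi>(1,2) lam] by metis
  note \<zeta> = schwarz_function_mult_delta[OF lam a']
  have nz: "1 + of_real B * \<eta> w \<in> - {0}" if "schwarz_function \<eta>" "w \<in> unit_disc" for \<eta> w
    using Re_one_plus_pos[OF AB(3) schwarz_function_norm_lt_1[OF that(1)], of w] that(2) by force
  have az0: "cmod (a * z0) < 1" using z0 a by (simp add: norm_mult)
  \<comment> \<open>The value at \<open>z0\<close> is unwound layer by layer: the nonzero factor
    cancels, then injectivity of \<open>Ln\<close> and of \<open>delta\<close> gives
    \<open>\<omega> z0 = a * z0\<close>.\<close>
  have "Ln (1 + of_real B * \<xi> z0) = Ln (1 + of_real B * (z0 * delta (a * z0) lam))"
    using eq \<xi>(3)[OF z0(1)] F(2)[OF z0(1)] AB by simp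
  then have "\<xi> z0 = z0 * delta (a * z0) lam"
    using inj_onD[OF inj_on_Ln _ nz[OF \<xi>(1) z0(1)] nz[OF \<zeta>(1) z0(1)]] AB by simp
  then have "delta (\<omega> z0) lam = delta (a * z0) lam"
    using \<omega>(2) z0 by simp
  then have \<omega>z0: "\<omega> z0 = a * z0"
    using delta_inverse'[OF _ lam] az0 schwarz_function_norm_lt_1[OF \<omega>(1)] z0 by (metis mem_ball_0)
  \<comment> \<open>Here \<open>cmod a = 1\<close> produces the equality case of the Schwarz lemma;
    the coefficient of the resulting linear map is fixed by its value at \<open>z0\<close>.\<close>
  then have "cmod (\<omega> z0) = cmod z0" using a by (simp add: norm_mult)
  then obtain \<alpha> where \<alpha>: "\<And>z. cmod z < 1 \<Longrightarrow> \<omega> z = \<alpha> * z"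
    using Schwarz_Lemma(3)[of \<omega> 0] \<omega>(1) schwarz_function_norm_lt_1[OF \<omega>(1)] z0
    unfolding schwarz_function_def by (metis mem_ball_0 norm_zero zero_less_one)
  then have "\<alpha> = a" using \<omega>z0 z0 by simp
  then have "deriv f w = deriv ?F w" if "w \<in> unit_disc" for w
    using \<xi>(3,4)[OF that] F(4)[OF that] \<omega>(2)[of w] \<alpha>[of w] that by simp
  moreover have "f field_differentiable at w" "?F field_differentiable at w" if "w \<in> unit_disc" for w
    using f F(3) that
    by (auto simp: class_C_lam_def class_C_def intro: holomorphic_on_imp_differentiable_at[of _ unit_disc])
  ultimately have "((\<lambda>w. f w - ?F w) has_field_derivative 0) (at w within unit_disc)"
    if "w \<in> unit_disc" for w
    using that DERIV_diff[of f "deriv f w" w unit_disc ?F "deriv ?F w"]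
    by (metis DERIV_deriv_iff_field_differentiable cancel_comm_monoid_add_class.diff_cancel
        has_field_derivative_at_within)
  then obtain c where "\<And>w. w \<in> unit_disc \<Longrightarrow> f w - ?F w = c"
    using has_field_derivative_zero_constant[of unit_disc "\<lambda>w. f w - ?F w"] by auto
  moreover have "f 0 - ?F 0 = 0"
    using f F(1) by (simp add: class_C_lam_def class_C_def)
  ultimately show ?thesis using z by (metis centre_in_ball eq_iff_diff_eq_0 zero_less_one)
qed

section \<open>The region, its boundary curve and uniqueness\<close>

theorem theorem2p2:
  fixes A B lam :: real and z0 :: complex
  assumes "-1 \<le> A" "A < B" "B \<le> 1" "B \<noteq> 0"
    and "0 \<le> lam" "lam < 1"
    and "z0 \<in> unit_disc - {0}"
  shows
    "V_region (of_real lam) z0 A B =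
       {of_real ((A - B) / B) * Ln (c_center B z0 lam + a * of_real (r_radius B z0 lam))
         | a :: complex. cmod a \<le> 1} \<and>
     (let \<gamma> = (\<lambda>\<theta>. log_of_deriv (F_ext A B (cis \<theta>) (of_real lam)) z0) in
       frontier (V_region (of_real lam) z0 A B) = \<gamma> ` {-pi<..pi} \<and>
       simple_path (\<gamma> \<circ> linepath (-pi) pi) \<and>
       pathfinish (\<gamma> \<circ> linepath (-pi) pi) = pathstart (\<gamma> \<circ> linepath (-pi) pi) \<and>
       (\<forall>\<theta>\<in>{-pi<..pi}. \<gamma> \<theta> =
          of_real ((A - B) / B) * Ln (1 + of_real B * z0 * delta (cis \<theta> * z0) (of_real lam)))) \<and>
     (\<forall>f\<in>class_C_lam (of_real lam) A B. \<forall>\<theta>\<in>{-pi<..pi}.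
        log_of_deriv f z0 = log_of_deriv (F_ext A B (cis \<theta>) (of_real lam)) z0 \<longrightarrow>
        (\<forall>z\<in>unit_disc. f z = F_ext A B (cis \<theta>) (of_real lam) z))"
proof -
  have AB: "A \<noteq> B" "B \<noteq> 0" "\<bar>B\<bar> \<le> 1" using assms by auto
  have z0: "z0 \<in> unit_disc" "cmod z0 < 1" "z0 \<noteq> 0" using assms by auto
  have lam: "cmod (of_real lam) < 1" using assms by simp
  note ctx = AB(2) assms(5,6) z0(2,3)
  define k :: complex where "k = of_real ((A - B) / B)"
  have k: "k \<noteq> 0" using AB by (simp add: k_def)
  \<comment> \<open>The region will be the image under \<open>G\<close> of a closed disc, and
    \<open>W\<close> the Moebius parametrisation of that disc, with unimodular parameters on its
    boundary circle.\<close>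
  define G where "G p = k * Ln p" for p
  define W where "W a = 1 + of_real B * (z0 * delta (a * z0) (of_real lam))" for a
  let ?V = "V_region (of_real lam) z0 A B"
  let ?c = "c_center B z0 lam" and ?r = "r_radius B z0 lam"
  define \<gamma> where "\<gamma> = (\<lambda>\<theta>. log_of_deriv (F_ext A B (cis \<theta>) (of_real lam)) z0)"
  define S where "S = {p. Re p > 0}"
  note F = F_ext_in_class_C_lam[OF AB lam]
  have \<gamma>: "\<gamma> \<theta> = G (W (cis \<theta>))" for \<theta>
    unfolding \<gamma>_def G_def W_def k_def using F(2)[of "cis \<theta>"] z0 by simp
  have cball: "cball ?c ?r = W ` {a. cmod a \<le> 1}" and sphere: "sphere ?c ?r = W ` {a. cmod a = 1}"
    unfolding W_def[abs_def] by (rule cball_center_eq[OF ctx] sphere_center_eq[OF ctx])+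
  have V: "?V = G ` cball ?c ?r"
  proof (intro equalityI subsetI)
    fix v assume "v \<in> ?V"
    then obtain f where f: "f \<in> class_C_lam (of_real lam) A B" "v = log_of_deriv f z0"
      by (auto simp: V_region_def)
    obtain \<xi> where \<xi>: "schwarz_function \<xi>" "deriv \<xi> 0 = of_real lam"
      "\<And>z. z \<in> unit_disc \<Longrightarrow> log_of_deriv f z = of_real ((A - B) / B) * Ln (1 + of_real B * \<xi> z)"
      using class_C_lamE[OF f(1) AB(1,2)] by metis
    obtain \<omega> where \<omega>: "schwarz_function \<omega>" "\<And>z. cmod z < 1 \<Longrightarrow> \<xi> z = z * delta (\<omega> z) (of_real lam)"
      using schwarz_function_factor[OF \<xi>(1,2) lam] by metis
    have "cmod (\<omega> z0) \<le> cmod z0"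
      using Schwarz_Lemma(1)[of \<omega>] \<omega>(1) schwarz_function_norm_lt_1[OF \<omega>(1)] z0
      unfolding schwarz_function_def by blast
    \<comment> \<open>This quotient is the parameter \<open>a\<close> belonging to
      \<open>f\<close>.\<close>
    then have "cmod (\<omega> z0 / z0) \<le> 1" using z0 by (simp add: norm_divide)
    moreover have "v = G (W (\<omega> z0 / z0))"
      using f(2) \<xi>(3)[OF z0(1)] \<omega>(2)[OF z0(2)] z0 by (simp add: G_def W_def k_def)
    ultimately show "v \<in> G ` cball ?c ?r" unfolding cball by blast
  next
    fix v assume "v \<in> G ` cball ?c ?r"
    then obtain a where a: "cmod a \<le> 1" "v = G (W a)" unfolding cball by blast
    then have "v = log_of_deriv (F_ext A B a (of_real lam)) z0"
      using F(2)[OF a(1) z0(1)] by (simp add: G_def W_def k_def)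
    then show "v \<in> ?V" using F(1)[OF a(1)] by (auto simp: V_region_def)
  qed
  have cball_S: "cball ?c ?r \<subseteq> S"
  proof -
    \<comment> \<open>No estimate of centre and radius is needed: \<open>W a\<close> is 1 plus
      \<open>B\<close> times the value of a Schwarz function at \<open>z0\<close>.\<close>
    have "W a \<in> S" if "cmod a \<le> 1" for a
      unfolding W_def S_def
      using Re_one_plus_pos[OF AB(3) schwarz_function_norm_lt_1[OF schwarz_function_mult_delta(1)[OF lam that] z0(2)]]
      by simp
    then show ?thesis unfolding cball by blast
  qed
  have contG: "continuous_on S G"
    unfolding G_def[abs_def] S_def
    by (intro continuous_intros) (auto simp: complex_nonpos_Reals_iff)
  have injG: "inj_on G S"
    using inj_on_subset[OF inj_on_Ln, of S] k by (force simp: inj_on_def G_def S_def)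
  have "open S" unfolding S_def by (rule open_halfspace_Re_gt)
  have frontier: "frontier ?V = \<gamma> ` {-pi<..pi}"
    unfolding V frontier_inj_image_compact[OF \<open>open S\<close> contG injG compact_cball cball_S] frontier_cball
      sphere cis_image[symmetric] by (auto simp: \<gamma>)
  \<comment> \<open>The parameter here is affine and in general differs from that of
    \<open>W\<close>; only the two image sets coincide.\<close>
  have cballp: "cball ?c ?r = (\<lambda>a. ?c + a * of_real ?r) ` {a. cmod a \<le> 1}"
  proof -
    have r: "?r > 0" by (rule r_radius_pos[OF ctx])
    show ?thesis
    proof (intro equalityI subsetI)
      fix p assume "p \<in> cball ?c ?r"
      then show "p \<in> (\<lambda>a. ?c + a * of_real ?r) ` {a. cmod a \<le> 1}"
        using r by (intro image_eqI[of _ _ "(p - ?c) / of_real ?r"])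
          (auto simp: dist_norm norm_divide norm_minus_commute)
    next
      fix p assume "p \<in> (\<lambda>a. ?c + a * of_real ?r) ` {a. cmod a \<le> 1}"
      then show "p \<in> cball ?c ?r"
        using r by (auto simp: dist_norm norm_mult)
    qed
  qed
  have V_set: "?V = {of_real ((A - B) / B) * Ln (?c + a * of_real ?r) | a :: complex. cmod a \<le> 1}"
    unfolding V cballp by (auto simp: G_def k_def)
  have injW: "inj_on W {a. cmod a = 1}"
  proof (rule inj_onI)
    fix a b assume ab: "a \<in> {a. cmod a = 1}" "b \<in> {a. cmod a = 1}" "W a = W b"
    then have eq: "delta (a * z0) (of_real lam) = delta (b * z0) (of_real lam)"
      using z0 AB by (simp add: W_def)
    have "cmod (a * z0) < 1" "cmod (b * z0) < 1" using ab(1,2) z0 by (simp_all add: norm_mult)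
    from this[THEN delta_inverse', OF lam] have "a * z0 = b * z0" unfolding eq by (rule trans[OF sym])
    then show "a = b" using z0 by simp
  qed
  have contW: "continuous_on {a. cmod a = 1} W"
  proof -
    have "continuous_on (ball 0 1) (\<lambda>w. delta w (of_real lam))"
      using delta_holomorphic[OF lam] by (rule holomorphic_on_imp_continuous_on)
    then have "continuous_on {a. cmod a = 1} (\<lambda>a. delta (a * z0) (of_real lam))"
      by (rule continuous_on_compose2) (use z0 in \<open>auto intro!: continuous_intros simp: norm_mult\<close>)
    then show ?thesis unfolding W_def[abs_def] by (intro continuous_intros)
  qed
  have WS: "W ` {a. cmod a = 1} \<subseteq> S"
    using sphere_cball cball_S unfolding sphere[symmetric] by blast
  have "simple_path ((\<lambda>\<theta>. (G \<circ> W) (cis \<theta>)) \<circ> linepath (- pi) pi)"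
    by (intro simple_path_cis_compose continuous_on_compose comp_inj_on contW injW
        continuous_on_subset[OF contG WS] inj_on_subset[OF injG WS])
  then have simple: "simple_path (\<gamma> \<circ> linepath (-pi) pi)"
    by (simp add: \<gamma>[abs_def])
  \<comment> \<open>The curve closes up because \<open>cis (-pi)\<close> and \<open>cis pi\<close>
    are both -1.\<close>
  have loop: "pathfinish (\<gamma> \<circ> linepath (-pi) pi) = pathstart (\<gamma> \<circ> linepath (-pi) pi)"
    by (simp add: pathfinish_compose pathstart_compose \<gamma> complex_eq_iff flip: cis_cnj)
  have formula: "\<gamma> \<theta> = of_real ((A - B) / B) * Ln (1 + of_real B * z0 * delta (cis \<theta> * z0) (of_real lam))" for \<theta>
    by (simp add: \<gamma> G_def W_def k_def mult.assoc)
  have unique: "\<forall>f\<in>class_C_lam (of_real lam) A B. \<forall>\<theta>\<in>{-pi<..pi}.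
        log_of_deriv f z0 = log_of_deriv (F_ext A B (cis \<theta>) (of_real lam)) z0 \<longrightarrow>
        (\<forall>z\<in>unit_disc. f z = F_ext A B (cis \<theta>) (of_real lam) z)"
    using class_C_lam_eq_F_ext[OF AB lam z0(1,3)] by simp
  show ?thesis
    using V_set frontier simple loop formula unique unfolding Let_def \<gamma>_def[symmetric] by blast
qed

end
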